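(* Let $\mathsf{CS}$ be any constant specification for $\mathsf{LPLTL}^{\mathsf P}$. For every formula $\phi$ and every finite set of formulas $\Gamma$: if $\Gamma\vdash_{\mathsf{CS}}\phi$, then $\Gamma\Vdash_{\mathsf{CS}}\phi$.
   Context: Language. Fix $h\ge 1$ agents $\mathsf{Ag}=\{1,\dots,h\}$ and countable sets of justification constants, justification variables, and atomic propositions $\mathsf{Prop}$. Terms: $t::=c\mid x\mid\ !t\mid t+t\mid t\cdot t$. Formulas: $\phi::=P\mid\bot\mid\phi\to\phi\mid\bigcirc\phi\mid\mathsf{Y}_w\phi\mid\phi\,\mathcal{U}\,\phi\mid\phi\,\mathcal{S}\,\phi\mid[t]_i\phi$ ($\bigcirc$ next, $\mathsf{Y}_w$ weak previous, $\mathcal U$ until, $\mathcal S$ since). Abbreviations: $\neg\phi:=\phi\to\bot$, $\top:=\neg\bot$, usual $\lor,\land,\leftrightarrow$; $\mathsf{Y}_s\phi:=\neg\mathsf{Y}_w\neg\phi$; $\Diamond\phi:=\top\,\mathcal U\,\phi$; $\Box\phi:=\neg\Diamond\neg\phi$; $\Diamond^{-}\phi:=\top\,\mathcal S\,\phi$; $\boxminus\phi:=\neg\Diamond^{-}\neg\phi$. The system $\mathsf{LPLTL}^{\mathsf P}$. Axioms: all propositional tautologies; $\bigcirc(\phi\to\psi)\to(\bigcirc\phi\to\bigcirc\psi)$; $\Box(\phi\to\psi)\to(\Box\phi\to\Box\psi)$; $\bigcirc\neg\phi\leftrightarrow\neg\bigcirc\phi$; $\Box(\phi\to\bigcirc\phi)\to(\phi\to\Box\phi)$;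 $\phi\,\mathcal U\,\psi\to\Diamond\psi$; $\phi\,\mathcal U\,\psi\leftrightarrow\psi\lor(\phi\land\bigcirc(\phi\,\mathcal U\,\psi))$; $\boxminus(\phi\to\psi)\to(\boxminus\phi\to\boxminus\psi)$; $\mathsf Y_w(\phi\to\psi)\to(\mathsf Y_w\phi\to\mathsf Y_w\psi)$; $\mathsf Y_s\phi\to\mathsf Y_w\phi$; $\phi\to\bigcirc\mathsf Y_s\phi$; $\phi\to\mathsf Y_w\bigcirc\phi$; $\Diamond^{-}\mathsf Y_w\bot$; $\boxminus(\phi\to\mathsf Y_w\phi)\to(\phi\to\boxminus\phi)$; $\phi\,\mathcal S\,\psi\to\Diamond^{-}\psi$; $\phi\,\mathcal S\,\psi\leftrightarrow\psi\lor(\phi\land\mathsf Y_s(\phi\,\mathcal S\,\psi))$; and for all agents $i$, terms $s,t$: $[t]_i(\phi\to\psi)\to([s]_i\phi\to[t\cdot s]_i\psi)$; $[t]_i\phi\to[t+s]_i\phi$ and $[s]_i\phi\to[t+s]_i\phi$; $[t]_i\phi\to\phi$; $[t]_i\phi\to[!t]_i[t]_i\phi$. A constant specification $\mathsf{CS}$ is a set of formulas $[c_n]_{i_n}\cdots[c_1]_{i_1}\phi$ ($n\ge1$, $c_k$ constants, $i_k$ agents, $\phi$ an axiom instance), downward closed: if $[c_n]_{i_n}[c_{n-1}]_{i_{n-1}}\cdots[c_1]_{i_1}\phi\in\mathsf{CS}$ with $n>1$ then $[c_{n-1}]_{i_{n-1}}\cdots[c_1]_{i_1}\phi\in\mathsf{CS}$.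 Rules: modus ponens; from $\vdash\phi$ infer each of $\vdash\bigcirc\phi$, $\vdash\mathsf Y_w\phi$, $\vdash\Box\phi$, $\vdash\boxminus\phi$; and $\vdash\psi$ for every $\psi\in\mathsf{CS}$. $\Gamma\vdash_{\mathsf{CS}}\phi$ iff there are $\psi_1,\dots,\psi_n\in\Gamma$ with $\vdash_{\mathsf{CS}}(\psi_1\land\dots\land\psi_n)\to\phi$. Models. An $\mathsf{LPLTL}^{\mathsf P}_{\mathsf{CS}}$-model is $\mathcal M=(r,S,\mathcal E_1,\dots,\mathcal E_h,\nu)$ with $S$ nonempty, $r:\mathbb N\to S$, $\nu:S\to\mathcal P(\mathsf{Prop})$, and each $\mathcal E_i:S\times\mathsf{Tm}\to\mathcal P(\mathsf{Fml})$ satisfying, for all $w,s,t,\phi,\psi$: $[t]_i\phi\in\mathsf{CS}$ implies $\phi\in\mathcal E_i(w,t)$; $\phi\to\psi\in\mathcal E_i(w,t)$ and $\phi\in\mathcal E_i(w,s)$ imply $\psi\in\mathcal E_i(w,t\cdot s)$; $\mathcal E_i(w,s)\cup\mathcal E_i(w,t)\subseteq\mathcal E_i(w,s+t)$; $\phi\in\mathcal E_i(w,t)$ implies $[t]_i\phi\in\mathcal E_i(w,!t)$. Truth at time $n$, written $(\mathcal M,r(n))\models\phi$: $P$ iff $P\in\nu(r(n))$; $\bot$ never; $\to$ classically; $\mathsf Y_w\phi$ iff $n=0$ or $\phi$ at $n-1$; $\bigcirc\phi$ iff $\phi$ at $n+1$; $\phi\,\mathcal S\,\psi$ iff some $m\le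 n$ has $\psi$ at $m$ and $\phi$ at all $k$ with $m<k\le n$; $\phi\,\mathcal U\,\psi$ iff some $m\ge n$ has $\psi$ at $m$ and $\phi$ at all $k$ with $n\le k<m$; $[t]_i\phi$ iff $\phi\in\mathcal E_i(r(n),t)$ and $\phi$ holds at $n$. $\Gamma\Vdash_{\mathsf{CS}}\phi$ means: for every $\mathsf{LPLTL}^{\mathsf P}_{\mathsf{CS}}$-model and every $n$, if all members of $\Gamma$ hold at $n$ then $\phi$ holds at $n$. *)

theory Defs
  imports Main "HOL-Library.Countable"
begin

(* Type parameters: 'c justification constants, 'x justification variables,
   'a agents, 'p atomic propositions, 's states of a model. *)

datatype ('c, 'x) tm =
    Const 'c
  | Var 'x
  | Bang "('c, 'x) tm"
  | Plus "('c, 'x) tm" "('c, 'x) tm"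
  | App "('c, 'x) tm" "('c, 'x) tm"

datatype ('c, 'x, 'a, 'p) fm =
    Atom 'p
  | Falsum
  | Imp "('c, 'x, 'a, 'p) fm" "('c, 'x, 'a, 'p) fm"  (infixr "\<^bold>\<rightarrow>" 60)
  | Next "('c, 'x, 'a, 'p) fm"
  | WeakPrev "('c, 'x, 'a, 'p) fm"
  | Until "('c, 'x, 'a, 'p) fm" "('c, 'x, 'a, 'p) fm"
  | Since "('c, 'x, 'a, 'p) fm" "('c, 'x, 'a, 'p) fm"
  | Just 'a "('c, 'x) tm" "('c, 'x, 'a, 'p) fm"

abbreviation Neg :: "('c, 'x, 'a, 'p) fm \<Rightarrow> ('c, 'x, 'a, 'p) fm"  ("\<^bold>\<not> _" [75] 75) where
  "\<^bold>\<not> \<phi> \<equiv> \<phi> \<^bold>\<rightarrow> Falsum"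

abbreviation Verum :: "('c, 'x, 'a, 'p) fm" where
  "Verum \<equiv> \<^bold>\<not> Falsum"

abbreviation Or :: "('c, 'x, 'a, 'p) fm \<Rightarrow> ('c, 'x, 'a, 'p) fm \<Rightarrow> ('c, 'x, 'a, 'p) fm"
    (infixr "\<^bold>\<or>" 65) where
  "\<phi> \<^bold>\<or> \<psi> \<equiv> \<^bold>\<not> \<phi> \<^bold>\<rightarrow> \<psi>"

abbreviation And :: "('c, 'x, 'a, 'p) fm \<Rightarrow> ('c, 'x, 'a, 'p) fm \<Rightarrow> ('c, 'x, 'a, 'p) fm"
    (infixr "\<^bold>\<and>" 70) where
  "\<phi> \<^bold>\<and> \<psi> \<equiv> \<^bold>\<not> (\<phi> \<^bold>\<rightarrow> \<^bold>\<not> \<psi>)"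

abbreviation Iff :: "('c, 'x, 'a, 'p) fm \<Rightarrow> ('c, 'x, 'a, 'p) fm \<Rightarrow> ('c, 'x, 'a, 'p) fm"
    (infixr "\<^bold>\<leftrightarrow>" 55) where
  "\<phi> \<^bold>\<leftrightarrow> \<psi> \<equiv> (\<phi> \<^bold>\<rightarrow> \<psi>) \<^bold>\<and> (\<psi> \<^bold>\<rightarrow> \<phi>)"

abbreviation StrongPrev :: "('c, 'x, 'a, 'p) fm \<Rightarrow> ('c, 'x, 'a, 'p) fm" where
  "StrongPrev \<phi> \<equiv> \<^bold>\<not> (WeakPrev (\<^bold>\<not> \<phi>))"

abbreviation Eventually :: "('c, 'x, 'a, 'p) fm \<Rightarrow> ('c, 'x, 'a, 'p) fm" where
  "Eventually \<phi> \<equiv> Until Verum \<phi>"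

abbreviation Always :: "('c, 'x, 'a, 'p) fm \<Rightarrow> ('c, 'x, 'a, 'p) fm" where
  "Always \<phi> \<equiv> \<^bold>\<not> (Eventually (\<^bold>\<not> \<phi>))"

abbreviation Once :: "('c, 'x, 'a, 'p) fm \<Rightarrow> ('c, 'x, 'a, 'p) fm" where
  "Once \<phi> \<equiv> Since Verum \<phi>"

abbreviation Historically :: "('c, 'x, 'a, 'p) fm \<Rightarrow> ('c, 'x, 'a, 'p) fm" where
  "Historically \<phi> \<equiv> \<^bold>\<not> (Once (\<^bold>\<not> \<phi>))"

(* Propositional evaluation: every formula whose outermost constructor is neither
   Falsum nor Imp counts as a propositional atom, so that the tautologies are exactly
   the substitution instances of classical propositional tautologies. *)
fun prop_eval :: "(('c, 'x, 'a, 'p) fm \<Rightarrow> bool) \<Rightarrow> ('c, 'x, 'a, 'p) fm \<Rightarrow> bool" where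
  "prop_eval v Falsum = False"
| "prop_eval v (\<phi> \<^bold>\<rightarrow> \<psi>) = (prop_eval v \<phi> \<longrightarrow> prop_eval v \<psi>)"
| "prop_eval v \<phi> = v \<phi>"

definition tautology :: "('c, 'x, 'a, 'p) fm \<Rightarrow> bool" where
  "tautology \<phi> \<longleftrightarrow> (\<forall>v. prop_eval v \<phi>)"

inductive is_axiom :: "('c, 'x, 'a, 'p) fm \<Rightarrow> bool" where
  Taut: "tautology \<phi> \<Longrightarrow> is_axiom \<phi>"
| Next_K: "is_axiom (Next (\<phi> \<^bold>\<rightarrow> \<psi>) \<^bold>\<rightarrow> (Next \<phi> \<^bold>\<rightarrow> Next \<psi>))"
| Always_K: "is_axiom (Always (\<phi> \<^bold>\<rightarrow> \<psi>) \<^bold>\<rightarrow> (Always \<phi> \<^bold>\<rightarrow> Always \<psi>))"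
| Next_fun: "is_axiom (Next (\<^bold>\<not> \<phi>) \<^bold>\<leftrightarrow> \<^bold>\<not> (Next \<phi>))"
| Always_ind: "is_axiom (Always (\<phi> \<^bold>\<rightarrow> Next \<phi>) \<^bold>\<rightarrow> (\<phi> \<^bold>\<rightarrow> Always \<phi>))"
| Until_ev: "is_axiom (Until \<phi> \<psi> \<^bold>\<rightarrow> Eventually \<psi>)"
| Until_unfold: "is_axiom (Until \<phi> \<psi> \<^bold>\<leftrightarrow> \<psi> \<^bold>\<or> (\<phi> \<^bold>\<and> Next (Until \<phi> \<psi>)))"
| Hist_K: "is_axiom (Historically (\<phi> \<^bold>\<rightarrow> \<psi>) \<^bold>\<rightarrow> (Historically \<phi> \<^bold>\<rightarrow> Historically \<psi>))"
| WeakPrev_K: "is_axiom (WeakPrev (\<phi> \<^bold>\<rightarrow> \<psi>) \<^bold>\<rightarrow> (WeakPrev \<phi> \<^bold>\<rightarrow> WeakPrev \<psi>))"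
| Strong_weak: "is_axiom (StrongPrev \<phi> \<^bold>\<rightarrow> WeakPrev \<phi>)"
| Next_prev: "is_axiom (\<phi> \<^bold>\<rightarrow> Next (StrongPrev \<phi>))"
| Prev_next: "is_axiom (\<phi> \<^bold>\<rightarrow> WeakPrev (Next \<phi>))"
| Initial: "is_axiom (Once (WeakPrev Falsum))"
| Hist_ind: "is_axiom (Historically (\<phi> \<^bold>\<rightarrow> WeakPrev \<phi>) \<^bold>\<rightarrow> (\<phi> \<^bold>\<rightarrow> Historically \<phi>))"
| Since_once: "is_axiom (Since \<phi> \<psi> \<^bold>\<rightarrow> Once \<psi>)"
| Since_unfold: "is_axiom (Since \<phi> \<psi> \<^bold>\<leftrightarrow> \<psi> \<^bold>\<or> (\<phi> \<^bold>\<and> StrongPrev (Since \<phi> \<psi>)))"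
| Application: "is_axiom (Just i t (\<phi> \<^bold>\<rightarrow> \<psi>) \<^bold>\<rightarrow> (Just i s \<phi> \<^bold>\<rightarrow> Just i (App t s) \<psi>))"
| Sum_left: "is_axiom (Just i t \<phi> \<^bold>\<rightarrow> Just i (Plus t s) \<phi>)"
| Sum_right: "is_axiom (Just i s \<phi> \<^bold>\<rightarrow> Just i (Plus t s) \<phi>)"
| Factivity: "is_axiom (Just i t \<phi> \<^bold>\<rightarrow> \<phi>)"
| Introspection: "is_axiom (Just i t \<phi> \<^bold>\<rightarrow> Just i (Bang t) (Just i t \<phi>))"

(* The list is read from the outside in: its head is the outermost constant and agent. *)
fun const_just :: "('c \<times> 'a) list \<Rightarrow> ('c, 'x, 'a, 'p) fm \<Rightarrow> ('c, 'x, 'a, 'p) fm" where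
  "const_just [] \<phi> = \<phi>"
| "const_just ((c, i) # ks) \<phi> = Just i (Const c) (const_just ks \<phi>)"

definition constant_specification :: "('c, 'x, 'a, 'p) fm set \<Rightarrow> bool" where
  "constant_specification CS \<longleftrightarrow>
     (\<forall>\<chi>\<in>CS. \<exists>ks \<phi>. ks \<noteq> [] \<and> is_axiom \<phi> \<and> \<chi> = const_just ks \<phi>) \<and>
     (\<forall>k ks \<phi>. ks \<noteq> [] \<longrightarrow> is_axiom \<phi> \<longrightarrow> const_just (k # ks) \<phi> \<in> CS \<longrightarrow> const_just ks \<phi> \<in> CS)"

inductive derivable :: "('c, 'x, 'a, 'p) fm set \<Rightarrow> ('c, 'x, 'a, 'p) fm \<Rightarrow> bool"
  for CS :: "('c, 'x, 'a, 'p) fm set" where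
  Ax: "is_axiom \<phi> \<Longrightarrow> derivable CS \<phi>"
| MP: "derivable CS (\<phi> \<^bold>\<rightarrow> \<psi>) \<Longrightarrow> derivable CS \<phi> \<Longrightarrow> derivable CS \<psi>"
| Next_nec: "derivable CS \<phi> \<Longrightarrow> derivable CS (Next \<phi>)"
| WeakPrev_nec: "derivable CS \<phi> \<Longrightarrow> derivable CS (WeakPrev \<phi>)"
| Always_nec: "derivable CS \<phi> \<Longrightarrow> derivable CS (Always \<phi>)"
| Hist_nec: "derivable CS \<phi> \<Longrightarrow> derivable CS (Historically \<phi>)"
| Const_nec: "\<psi> \<in> CS \<Longrightarrow> derivable CS \<psi>"

(* The empty conjunction is Verum. *)
fun conj_list :: "('c, 'x, 'a, 'p) fm list \<Rightarrow> ('c, 'x, 'a, 'p) fm" where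
  "conj_list [] = Verum"
| "conj_list [\<phi>] = \<phi>"
| "conj_list (\<phi> # \<psi> # \<psi>s) = \<phi> \<^bold>\<and> conj_list (\<psi> # \<psi>s)"

definition derivable_from ::
    "('c, 'x, 'a, 'p) fm set \<Rightarrow> ('c, 'x, 'a, 'p) fm set \<Rightarrow> ('c, 'x, 'a, 'p) fm \<Rightarrow> bool" where
  "derivable_from CS \<Gamma> \<phi> \<longleftrightarrow> (\<exists>\<psi>s. set \<psi>s \<subseteq> \<Gamma> \<and> derivable CS (conj_list \<psi>s \<^bold>\<rightarrow> \<phi>))"

record ('c, 'x, 'a, 'p, 's) interp =
  run :: "nat \<Rightarrow> 's"
  states :: "'s set"
  evidence :: "'a \<Rightarrow> 's \<Rightarrow> ('c, 'x) tm \<Rightarrow> ('c, 'x, 'a, 'p) fm set"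
  valuation :: "'s \<Rightarrow> 'p set"

definition is_model ::
    "('c, 'x, 'a, 'p) fm set \<Rightarrow> ('c, 'x, 'a, 'p, 's) interp \<Rightarrow> bool" where
  "is_model CS M \<longleftrightarrow>
     states M \<noteq> {} \<and>
     (\<forall>n. run M n \<in> states M) \<and>
     (\<forall>i. \<forall>w\<in>states M.
        (\<forall>t \<phi>. Just i t \<phi> \<in> CS \<longrightarrow> \<phi> \<in> evidence M i w t) \<and>
        (\<forall>s t \<phi> \<psi>. (\<phi> \<^bold>\<rightarrow> \<psi>) \<in> evidence M i w t \<longrightarrow> \<phi> \<in> evidence M i w s \<longrightarrow>
           \<psi> \<in> evidence M i w (App t s)) \<and>
        (\<forall>s t. evidence M i w s \<union> evidence M i w t \<subseteq> evidence M i w (Plus s t)) \<and>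
        (\<forall>t \<phi>. \<phi> \<in> evidence M i w t \<longrightarrow> Just i t \<phi> \<in> evidence M i w (Bang t)))"

primrec holds_at ::
    "('c, 'x, 'a, 'p, 's) interp \<Rightarrow> nat \<Rightarrow> ('c, 'x, 'a, 'p) fm \<Rightarrow> bool" where
  "holds_at M n (Atom P) \<longleftrightarrow> P \<in> valuation M (run M n)"
| "holds_at M n Falsum \<longleftrightarrow> False"
| "holds_at M n (\<phi> \<^bold>\<rightarrow> \<psi>) \<longleftrightarrow> (holds_at M n \<phi> \<longrightarrow> holds_at M n \<psi>)"
| "holds_at M n (Next \<phi>) \<longleftrightarrow> holds_at M (n + 1) \<phi>"
| "holds_at M n (WeakPrev \<phi>) \<longleftrightarrow> n = 0 \<or> holds_at M (n - 1) \<phi>"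
| "holds_at M n (Until \<phi> \<psi>) \<longleftrightarrow>
     (\<exists>m\<ge>n. holds_at M m \<psi> \<and> (\<forall>k. n \<le> k \<and> k < m \<longrightarrow> holds_at M k \<phi>))"
| "holds_at M n (Since \<phi> \<psi>) \<longleftrightarrow>
     (\<exists>m\<le>n. holds_at M m \<psi> \<and> (\<forall>k. m < k \<and> k \<le> n \<longrightarrow> holds_at M k \<phi>))"
| "holds_at M n (Just i t \<phi>) \<longleftrightarrow> \<phi> \<in> evidence M i (run M n) t \<and> holds_at M n \<phi>"

(* The type argument fixes the type from which the state sets are drawn; a statement
   with a free type variable there ranges over the models on all types. *)
definition consequence ::
    "'s itself \<Rightarrow> ('c, 'x, 'a, 'p) fm set \<Rightarrow> ('c, 'x, 'a, 'p) fm set \<Rightarrow>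
     ('c, 'x, 'a, 'p) fm \<Rightarrow> bool" where
  "consequence (_ :: 's itself) CS \<Gamma> \<phi> \<longleftrightarrow>
     (\<forall>(M :: ('c, 'x, 'a, 'p, 's) interp) n. is_model CS M \<longrightarrow>
        (\<forall>\<psi>\<in>\<Gamma>. holds_at M n \<psi>) \<longrightarrow> holds_at M n \<phi>)"

end

theory Submission
  imports Defs
begin

text \<open>Soundness by induction on derivations: a theorem of the calculus is true at every time
  of every model (\<open>derivable_holds\<close>). Axioms are checked one by one in
  \<open>axiom_holds\<close>: temporal ones by arithmetic on time points or induction along the run,
  justification ones by the closure conditions on evidence together with truth of the justified
  formula. Members of the constant specification need both its downward closure and the evidence
  condition of models (\<open>constant_specification_holds\<close>). Premises enter only through a
  derivable implication from their conjunction, so the local consequence relation follows by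
  evaluating that implication at the given time.\<close>

text \<open>Truth at a fixed time treats \<open>Falsum\<close> and implication classically, so it is
  itself one of the valuations over which \<open>tautology\<close> quantifies.\<close>

lemma holds_at_prop_eval: "holds_at M n \<phi> \<longleftrightarrow> prop_eval (holds_at M n) \<phi>"
  by (induction \<phi>) auto

lemma tautology_holds: "tautology \<phi> \<Longrightarrow> holds_at M n \<phi>"
  unfolding tautology_def using holds_at_prop_eval by blast

lemma holds_at_Always: "holds_at M n (Always \<phi>) \<longleftrightarrow> (\<forall>m\<ge>n. holds_at M m \<phi>)"
  by auto

lemma holds_at_Historically: "holds_at M n (Historically \<phi>) \<longleftrightarrow> (\<forall>m\<le>n. holds_at M m \<phi>)"
  by auto

text \<open>The witness is either the present moment or a later one, and a later one also serves
  from \<open>Suc n\<close>.\<close>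

lemma holds_at_Until_unfold:
  "holds_at M n (Until \<phi> \<psi>) \<longleftrightarrow>
     holds_at M n \<psi> \<or> holds_at M n \<phi> \<and> holds_at M (Suc n) (Until \<phi> \<psi>)"
proof
  assume "holds_at M n (Until \<phi> \<psi>)"
  then obtain m where m: "m \<ge> n" "holds_at M m \<psi>" "\<And>k. n \<le> k \<Longrightarrow> k < m \<Longrightarrow> holds_at M k \<phi>"
    by auto
  show "holds_at M n \<psi> \<or> holds_at M n \<phi> \<and> holds_at M (Suc n) (Until \<phi> \<psi>)"
  proof (cases "m = n")
    case False
    then have "Suc n \<le> m" "holds_at M n \<phi>" using m by auto
    with m show ?thesis by auto
  qed (use m in auto)
next
  assume "holds_at M n \<psi> \<or> holds_at M n \<phi> \<and> holds_at M (Suc n) (Until \<phi> \<psi>)"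
  then consider "holds_at M n \<psi>"
    | m where "holds_at M n \<phi>" "m \<ge> Suc n" "holds_at M m \<psi>"
        "\<And>k. Suc n \<le> k \<Longrightarrow> k < m \<Longrightarrow> holds_at M k \<phi>"
    by auto
  then show "holds_at M n (Until \<phi> \<psi>)"
  proof cases
    case (2 m)
    then have "\<forall>k. n \<le> k \<and> k < m \<longrightarrow> holds_at M k \<phi>"
      by (metis le_neq_implies_less Suc_leI)
    with 2 show ?thesis by (auto intro!: exI[of _ m])
  qed auto
qed

text \<open>Mirror image of the until case. The conjunct \<open>n \<noteq> 0\<close> is what
  \<open>StrongPrev\<close> adds over \<open>WeakPrev\<close>: a previous moment must exist.\<close>

lemma holds_at_Since_unfold:
  "holds_at M n (Since \<phi> \<psi>) \<longleftrightarrow>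
     holds_at M n \<psi> \<or> holds_at M n \<phi> \<and> n \<noteq> 0 \<and> holds_at M (n - 1) (Since \<phi> \<psi>)"
proof
  assume "holds_at M n (Since \<phi> \<psi>)"
  then obtain m where m: "m \<le> n" "holds_at M m \<psi>" "\<And>k. m < k \<Longrightarrow> k \<le> n \<Longrightarrow> holds_at M k \<phi>"
    by auto
  show "holds_at M n \<psi> \<or> holds_at M n \<phi> \<and> n \<noteq> 0 \<and> holds_at M (n - 1) (Since \<phi> \<psi>)"
  proof (cases "m = n")
    case False
    then have "n \<noteq> 0" "m \<le> n - 1" "holds_at M n \<phi>" using m by auto
    with m show ?thesis by auto
  qed (use m in auto)
next
  assume "holds_at M n \<psi> \<or> holds_at M n \<phi> \<and> n \<noteq> 0 \<and> holds_at M (n - 1) (Since \<phi> \<psi>)"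
  then consider "holds_at M n \<psi>"
    | m where "holds_at M n \<phi>" "n \<noteq> 0" "m \<le> n - 1" "holds_at M m \<psi>"
        "\<And>k. m < k \<Longrightarrow> k \<le> n - 1 \<Longrightarrow> holds_at M k \<phi>"
    by auto
  then show "holds_at M n (Since \<phi> \<psi>)"
  proof cases
    case (2 m)
    then have "holds_at M k \<phi>" if "m < k" "k \<le> n" for k
      using that by (cases "k = n") auto
    with 2 show ?thesis by (auto intro!: exI[of _ m])
  qed auto
qed

lemma holds_at_Always_ind:
  assumes "holds_at M n (Always (\<phi> \<^bold>\<rightarrow> Next \<phi>))" and "holds_at M n \<phi>"
  shows "holds_at M n (Always \<phi>)"
proof -
  have "holds_at M m \<phi>" if "n \<le> m" for m
    using that by (induction m rule: dec_induct) (use assms in \<open>auto simp: holds_at_Always\<close>)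
  then show ?thesis by (simp add: holds_at_Always)
qed

lemma holds_at_Historically_ind:
  assumes "holds_at M n (Historically (\<phi> \<^bold>\<rightarrow> WeakPrev \<phi>))" and "holds_at M n \<phi>"
  shows "holds_at M n (Historically \<phi>)"
proof -
  have "holds_at M m \<phi>" if "m \<le> n" for m
    using that
  proof (induction m rule: inc_induct)
    case (step m)
    then show ?case
      \<comment> \<open>The induction descends from \<open>n\<close>. At the nonzero time
        \<open>Suc m\<close>, weak previous really refers to \<open>m\<close>.\<close>
      using assms(1)[unfolded holds_at_Historically, rule_format, of "Suc m"] by simp
  qed (rule assms(2))
  then show ?thesis by (simp add: holds_at_Historically)
qed

lemma holds_at_ImpI: "(holds_at M n \<phi> \<Longrightarrow> holds_at M n \<psi>) \<Longrightarrow> holds_at M n (\<phi> \<^bold>\<rightarrow> \<psi>)"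
  by simp

lemma axiom_holds:
  assumes "is_model CS M" and "is_axiom \<phi>"
  shows "holds_at M n \<phi>"
proof -
  \<comment> \<open>The evidence conditions are available here because the run stays inside
    \<open>states M\<close>.\<close>
  have app: "\<psi> \<in> evidence M i (run M n) (App t s)"
    if "\<phi> \<^bold>\<rightarrow> \<psi> \<in> evidence M i (run M n) t" "\<phi> \<in> evidence M i (run M n) s" for i s t \<phi> \<psi>
    using assms(1) that unfolding is_model_def by blast
  have sum: "\<phi> \<in> evidence M i (run M n) (Plus s t)"
    if "\<phi> \<in> evidence M i (run M n) s \<union> evidence M i (run M n) t" for i s t \<phi>
    using assms(1) that unfolding is_model_def by blast
  have bang: "Just i t \<phi> \<in> evidence M i (run M n) (Bang t)"
    if "\<phi> \<in> evidence M i (run M n) t" for i t \<phi>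
    using assms(1) that unfolding is_model_def by blast
  from assms(2) show ?thesis
  proof cases
    case Taut
    then show ?thesis by (rule tautology_holds)
  next
    case (Always_K \<phi> \<psi>)
    show ?thesis unfolding Always_K
      by (rule holds_at_ImpI, rule holds_at_ImpI, unfold holds_at_Always, simp)
  next
    case (Hist_K \<phi> \<psi>)
    show ?thesis unfolding Hist_K
      by (rule holds_at_ImpI, rule holds_at_ImpI, unfold holds_at_Historically, simp)
  next
    case (Until_unfold \<phi> \<psi>)
    show ?thesis unfolding Until_unfold using holds_at_Until_unfold[of M n \<phi> \<psi>]
      \<comment> \<open>The clause for \<open>Until\<close> is withheld, so until formulas stay
        opaque and a propositional goal remains.\<close>
      by (simp only: holds_at.simps(2,3,4) Suc_eq_plus1) blast
  next
    case (Since_unfold \<phi> \<psi>)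
    show ?thesis unfolding Since_unfold using holds_at_Since_unfold[of M n \<phi> \<psi>]
      by (simp only: holds_at.simps(2,3,5)) blast
  next
    case (Always_ind \<phi>)
    show ?thesis unfolding Always_ind
      by (rule holds_at_ImpI, rule holds_at_ImpI, rule holds_at_Always_ind)
  next
    case (Hist_ind \<phi>)
    show ?thesis unfolding Hist_ind
      by (rule holds_at_ImpI, rule holds_at_ImpI, rule holds_at_Historically_ind)
  next
    case (Prev_next \<phi>)
    \<comment> \<open>At time 0 weak previous holds vacuously; otherwise stepping back and forth
      returns to \<open>n\<close>.\<close>
    then show ?thesis by (cases n) auto
  next
    case (Application i t \<phi> \<psi> s)
    then show ?thesis using app by auto
  next
    case (Sum_left i t \<phi> s)
    then show ?thesis using sum by auto
  next
    case (Sum_right i s \<phi> t)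
    then show ?thesis using sum by auto
  next
    case (Introspection i t \<phi>)
    then show ?thesis using bang by auto
  qed auto
qed

text \<open>Peel off the outermost constant: the model supplies its evidence, and the formula
  beneath is either an axiom or, by downward closure, again in \<open>CS\<close>.\<close>

lemma constant_specification_holds:
  assumes M: "is_model CS M" and CS: "constant_specification CS" and "\<chi> \<in> CS"
  shows "holds_at M n \<chi>"
proof -
  have just: "\<phi> \<in> evidence M i (run M n) t" if "Just i t \<phi> \<in> CS" for i t \<phi>
    using M that by (simp add: is_model_def)
  have *: "holds_at M n (const_just ks \<phi>)"
    if "is_axiom \<phi>" "ks \<noteq> []" "const_just ks \<phi> \<in> CS" for ks \<phi>
    using that(2,3)
  proof (induction ks)
    case (Cons k ks)
    obtain c i where k: "k = (c, i)" by fastforce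
    have "holds_at M n (const_just ks \<phi>)"
    proof (cases "ks = []")
      case True
      then show ?thesis using axiom_holds[OF M that(1)] by simp
    next
      case False
      moreover have "const_just ks \<phi> \<in> CS"
        using CS False that(1) Cons.prems(2) unfolding constant_specification_def by blast
      ultimately show ?thesis by (rule Cons.IH)
    qed
    then show ?case using just Cons.prems(2) k by simp
  qed simp
  obtain ks \<phi> where "ks \<noteq> []" "is_axiom \<phi>" "\<chi> = const_just ks \<phi>"
    using CS assms(3) unfolding constant_specification_def by meson
  with * assms(3) show ?thesis by simp
qed

lemma derivable_holds:
  assumes "is_model CS M" and "constant_specification CS" and "derivable CS \<phi>"
  shows "holds_at M n \<phi>"
  using assms(3)
\<comment> \<open>The time must vary, since the necessitation rules need their premise at other
  moments.\<close>
proof (induction arbitrary: n rule: derivable.induct)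
  case (Ax \<phi>)
  then show ?case by (rule axiom_holds[OF assms(1)])
next
  case (MP \<phi> \<psi>)
  then show ?case by simp
next
  case (Const_nec \<psi>)
  then show ?case by (rule constant_specification_holds[OF assms(1,2)])
qed simp_all

lemma holds_at_conj_list: "holds_at M n (conj_list \<psi>s) \<longleftrightarrow> (\<forall>\<psi>\<in>set \<psi>s. holds_at M n \<psi>)"
  by (induction \<psi>s rule: conj_list.induct) auto

theorem theorem4:
  fixes CS \<Gamma> :: "('c::countable, 'x::countable, 'a::finite, 'p::countable) fm set"
    and \<phi> :: "('c, 'x, 'a, 'p) fm"
  assumes "constant_specification CS"
    and "finite \<Gamma>"
    and "derivable_from CS \<Gamma> \<phi>"
  shows "consequence TYPE('s) CS \<Gamma> \<phi>"
proof -
  obtain \<psi>s where \<psi>s: "set \<psi>s \<subseteq> \<Gamma>" "derivable CS (conj_list \<psi>s \<^bold>\<rightarrow> \<phi>)"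
    using assms(3) unfolding derivable_from_def by blast
  show ?thesis
    unfolding consequence_def
  proof (intro allI impI)
    fix M :: "('c, 'x, 'a, 'p, 's) interp" and n
    assume M: "is_model CS M" and "\<forall>\<psi>\<in>\<Gamma>. holds_at M n \<psi>"
    then have "holds_at M n (conj_list \<psi>s)" using \<psi>s(1) by (auto simp: holds_at_conj_list)
    then show "holds_at M n \<phi>" using derivable_holds[OF M assms(1) \<psi>s(2), of n] by simp
  qed
qed

end
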